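(* For given $x_k\in\mathbb{R}^n$ and parameters $\mu_k>0$ and $\rho_k>0$, let $F_k(y)=L_B(y,x_k;\mu_k,\rho_k)$ and $y_k^*=\mathrm{argmin}_yF_k(y)$, and let $\{\hat y_\ell\}$ be generated from $\hat y_0\in\mathbb{R}^m$ by $$AA^T(\hat y_{\ell+1}-\hat y_\ell)=-(Az(\hat y_\ell,x_k;\mu_k,\rho_k)-\rho_kb),\qquad \ell=0,1,2,\dots.$$ Let $y^*$ be the solution of the linear program $\min_y\{-b^Ty:A^Ty\le c\}$, $x^*$ the associated Lagrange multiplier vector, and $s^*=c-A^Ty^*$. Suppose that $x^*+s^*>0$ (strict complementarity), and that with $\mathcal{I}=\{i\in\{1,\dots,n\}: x_i^*>0\}$ the columns $A_i$, $i\in\mathcal{I}$, of $A$ are linearly independent, $|\mathcal{I}|=m$, and $B=A_{\mathcal I}A_{\mathcal I}^T$ is positive definite. Then there is a scalar $\tau\in(0,1)$ such that $$\|\hat y_\ell-y_k^*\|^2_{AA^T}\le\tau^\ell\|\hat y_0-y_k^*\|^2_{AA^T}$$ for all $\ell\ge 0$. That is, $\{\hat y_\ell\}$ is of global linear convergence to $y_k^*$.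
   Context: $A\in\mathbb{R}^{m\times n}$, $b\in\mathbb{R}^m$, $c\in\mathbb{R}^n$ are given; $A_i$ denotes the $i$th column of $A$, and $A_{\mathcal I}$ the submatrix of $A$ with columns $A_i$, $i\in\mathcal I$; $\|v\|_M=\sqrt{v^TMv}$. That $x^*$ is the multiplier associated with $y^*$ means $Ax^*=b$, $x^*\ge0$, $A^Ty^*\le c$ and $x^*\circ s^*=0$ (componentwise product). For $\mu>0$, $\rho>0$, $y\in\mathbb{R}^m$, $x\in\mathbb{R}^n$ and $i=1,\dots,n$ define $$s_i(y,x;\mu,\rho)=\tfrac12\Big(\sqrt{(\rho x_i-c_i+A_i^Ty)^2+4\rho\mu}-(\rho x_i-c_i+A_i^Ty)\Big),$$ $$z_i(y,x;\mu,\rho)=\tfrac12\Big(\sqrt{(\rho x_i-c_i+A_i^Ty)^2+4\rho\mu}+(\rho x_i-c_i+A_i^Ty)\Big),$$ and $$L_B(y,x;\mu,\rho)=-\rho b^Ty+\sum_{i=1}^n\Big(-\rho\mu\ln s_i(y,x;\mu,\rho)+\tfrac12 z_i(y,x;\mu,\rho)^2-\tfrac12\rho^2x_i^2\Big).$$ The minimizer $y_k^*$ is taken to exist. *)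

theory Defs
  imports "HOL-Analysis.Analysis"
begin

definition lp_solution :: "real^'n^'m \<Rightarrow> real^'n \<Rightarrow> real^'m \<Rightarrow> real^'m \<Rightarrow> bool" where
  "lp_solution A c b y \<longleftrightarrow>
     is_arg_min (\<lambda>y. - (b \<bullet> y)) (\<lambda>y. \<forall>i. (transpose A *v y) $ i \<le> c $ i) y"

definition lp_multiplier ::
    "real^'n^'m \<Rightarrow> real^'m \<Rightarrow> real^'n \<Rightarrow> real^'m \<Rightarrow> real^'n \<Rightarrow> bool" where
  "lp_multiplier A b c y x \<longleftrightarrow>
     A *v x = b \<and> (\<forall>i. x $ i \<ge> 0) \<and> (\<forall>i. (transpose A *v y) $ i \<le> c $ i) \<and>
     (\<forall>i. x $ i * (c - transpose A *v y) $ i = 0)"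

definition svec ::
    "real^'n^'m \<Rightarrow> real^'n \<Rightarrow> real^'m \<Rightarrow> real^'n \<Rightarrow> real \<Rightarrow> real \<Rightarrow> real^'n" where
  "svec A c y x \<mu> \<rho> = (\<chi> i.
     (sqrt ((\<rho> * x $ i - c $ i + column i A \<bullet> y)\<^sup>2 + 4 * \<rho> * \<mu>)
       - (\<rho> * x $ i - c $ i + column i A \<bullet> y)) / 2)"

definition zvec ::
    "real^'n^'m \<Rightarrow> real^'n \<Rightarrow> real^'m \<Rightarrow> real^'n \<Rightarrow> real \<Rightarrow> real \<Rightarrow> real^'n" where
  "zvec A c y x \<mu> \<rho> = (\<chi> i.
     (sqrt ((\<rho> * x $ i - c $ i + column i A \<bullet> y)\<^sup>2 + 4 * \<rho> * \<mu>)
       + (\<rho> * x $ i - c $ i + column i A \<bullet> y)) / 2)"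

definition L\<^sub>B ::
    "real^'n^'m \<Rightarrow> real^'m \<Rightarrow> real^'n \<Rightarrow> real^'m \<Rightarrow> real^'n \<Rightarrow> real \<Rightarrow> real \<Rightarrow> real" where
  "L\<^sub>B A b c y x \<mu> \<rho> =
     - \<rho> * (b \<bullet> y)
     + (\<Sum>i\<in>UNIV. - \<rho> * \<mu> * ln (svec A c y x \<mu> \<rho> $ i)
          + (zvec A c y x \<mu> \<rho> $ i)\<^sup>2 / 2 - \<rho>\<^sup>2 * (x $ i)\<^sup>2 / 2)"

definition mnorm :: "real^'m^'m \<Rightarrow> real^'m \<Rightarrow> real" where
  "mnorm M v = sqrt (v \<bullet> (M *v v))"

definition positive_definite :: "real^'m^'m \<Rightarrow> bool" where
  "positive_definite M \<longleftrightarrow> transpose M = M \<and> (\<forall>v. v \<noteq> 0 \<longrightarrow> v \<bullet> (M *v v) > 0)"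

(* The index set I depends on data, so the submatrix A_I has no type of its own;
   this is the entrywise product of A_I with its transpose. *)
definition subgram :: "real^'n^'m \<Rightarrow> 'n set \<Rightarrow> real^'m^'m" where
  "subgram A I = (\<chi> p q. \<Sum>i\<in>I. A $ p $ i * A $ q $ i)"

(* Independence as a family: injectivity excludes repeated columns, which the
   image set alone would not detect. *)
definition columns_independent :: "real^'n^'m \<Rightarrow> 'n set \<Rightarrow> bool" where
  "columns_independent A I \<longleftrightarrow>
     inj_on (\<lambda>i. column i A) I \<and> independent ((\<lambda>i. column i A) ` I)"

end

(* The gradient of the barrier function is A z - rho b, so z at the minimizer y_k satisfies
   A z = rho b.  With u_l = A^T (yhat_l - y_k), the iteration then says that u_(l+1) is the
   orthogonal projection onto the row space of A of u_l - (z(yhat_l) - z(y_k)).  Each component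
   of z is an increasing contraction of the corresponding component of A^T y, whose difference
   quotients lie in (0,1) and, on bounded sets, are bounded away from 0.  Hence the norms of u_l
   decrease, so all u_l lie in one fixed ball, and there they decrease by a fixed factor.
   The squared norm of u_l is the squared AA^T-norm of yhat_l - y_k, and A^T is injective because
   A_I A_I^T is positive definite, so yhat_l tends to y_k. *)

theory Submission
  imports Defs
begin

text \<open>For K > 0 this is the positive root w of w^2 - t w - K/4 = 0, a smooth approximation of
  max(t, 0). With K = 4 rho mu, z and s are its values at t and -t, so both reduce to one scalar
  function.\<close>

definition smooth_pos :: "real \<Rightarrow> real \<Rightarrow> real" where
  "smooth_pos K t = (sqrt (t\<^sup>2 + K) + t) / 2"

lemma zvec_nth:
  "zvec A c y x \<mu> \<rho> $ i = smooth_pos (4 * \<rho> * \<mu>) (\<rho> * x $ i - c $ i + column i A \<bullet> y)"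
  by (simp add: zvec_def smooth_pos_def)

lemma svec_nth:
  "svec A c y x \<mu> \<rho> $ i = smooth_pos (4 * \<rho> * \<mu>) (- (\<rho> * x $ i - c $ i + column i A \<bullet> y))"
  by (simp only: svec_def smooth_pos_def vec_lambda_beta power2_minus add_uminus_conv_diff)

lemma abs_less_sqrt_square_add:
  fixes K t :: real
  assumes "K > 0"
  shows "\<bar>t\<bar> < sqrt (t\<^sup>2 + K)"
  using assms real_sqrt_less_mono[of "t\<^sup>2" "t\<^sup>2 + K"] by simp

lemma smooth_pos_pos: "K > 0 \<Longrightarrow> smooth_pos K t > 0"
  using abs_less_sqrt_square_add[of K t] by (simp add: smooth_pos_def)

text \<open>A difference of squares. For K = 4 rho mu it is the perturbed complementarity s z = rho
  mu.\<close>

lemma smooth_pos_mult_minus: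
  assumes "K > 0"
  shows "smooth_pos K (- t) * smooth_pos K t = K / 4"
proof -
  have "smooth_pos K (- t) * smooth_pos K t = ((sqrt (t\<^sup>2 + K))\<^sup>2 - t\<^sup>2) / 4"
    unfolding smooth_pos_def by (simp add: power2_eq_square field_simps)
  then show ?thesis using assms by (simp add: add_nonneg_pos less_imp_le)
qed

lemma has_field_derivative_smooth_pos:
  assumes "K > 0"
  shows "(smooth_pos K has_field_derivative smooth_pos K t / sqrt (t\<^sup>2 + K)) (at t)"
proof -
  have pos: "t\<^sup>2 + K > 0" using assms by (simp add: add_nonneg_pos)
  show ?thesis
    unfolding smooth_pos_def
    by (rule derivative_eq_intros refl | use pos in \<open>simp add: field_simps\<close>)+
qed

text \<open>This function is the y-dependent part of one summand of \<open>L\<^sub>B\<close>. With r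
  = sqrt(t^2 + K), the logarithm contributes K/(4r) and the square z^2/r. Since K/4 = s z and s + z
  = r, the sum collapses to z.\<close>

lemma has_field_derivative_barrier_term:
  assumes "K > 0"
  shows "((\<lambda>t. - (K / 4) * ln (smooth_pos K (- t)) + (smooth_pos K t)\<^sup>2 / 2)
           has_field_derivative smooth_pos K t) (at t)"
proof -
  let ?r = "sqrt (t\<^sup>2 + K)" and ?z = "smooth_pos K t" and ?s = "smooth_pos K (- t)"
  have r: "?r > 0" using assms by (simp add: add_nonneg_pos)
  have s: "?s > 0" using assms by (rule smooth_pos_pos)
  have sz: "?s + ?z = ?r" by (simp add: smooth_pos_def field_simps)
  have ds: "((\<lambda>t. smooth_pos K (- t)) has_field_derivative - (?s / ?r)) (at t)"
    using DERIV_chain2[OF has_field_derivative_smooth_pos[OF assms, of "- t"] DERIV_minus[OF DERIV_ident]]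
    by simp
  have "((\<lambda>t. - (K / 4) * ln (smooth_pos K (- t)) + (smooth_pos K t)\<^sup>2 / 2)
          has_field_derivative K / 4 / ?r + ?z\<^sup>2 / ?r) (at t)"
    by (rule derivative_eq_intros ds has_field_derivative_smooth_pos[OF assms] refl s
        | use s r in \<open>simp add: field_simps power2_eq_square\<close>)+
  moreover have "K / 4 / ?r + ?z\<^sup>2 / ?r = ?z * (?s + ?z) / ?r"
    unfolding smooth_pos_mult_minus[OF assms, of t, symmetric]
    by (simp add: power2_eq_square algebra_simps add_divide_distrib)
  ultimately show ?thesis using r by (simp add: sz)
qed

text \<open>Along a line each argument of \<open>smooth_pos\<close> is affine in r, with slope A_i^T
  h, so one-variable calculus yields the gradient A z - rho b tested against h.\<close>

lemma L\<^sub>B_directional_derivative: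
  assumes "\<mu> > 0" "\<rho> > 0"
  shows "((\<lambda>r. L\<^sub>B A b c (y + r *\<^sub>R h) x \<mu> \<rho>) has_field_derivative
           h \<bullet> (A *v zvec A c y x \<mu> \<rho> - \<rho> *\<^sub>R b)) (at 0)"
proof -
  define K where "K = 4 * \<rho> * \<mu>"
  have K: "K > 0" using assms by (simp add: K_def)
  define g where "g t = - (K / 4) * ln (smooth_pos K (- t)) + (smooth_pos K t)\<^sup>2 / 2" for t
  define p where "p i = \<rho> * x $ i - c $ i + column i A \<bullet> y" for i
  define q where "q i = column i A \<bullet> h" for i
  have eq: "L\<^sub>B A b c (y + r *\<^sub>R h) x \<mu> \<rho> =
      - \<rho> * (b \<bullet> y + r * (b \<bullet> h)) + (\<Sum>i\<in>UNIV. g (p i + r * q i) - \<rho>\<^sup>2 * (x $ i)\<^sup>2 / 2)" for r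
  proof -
    have "\<rho> * x $ i - c $ i + column i A \<bullet> (y + r *\<^sub>R h) = p i + r * q i" for i
      by (simp add: p_def q_def inner_add_right)
    then show ?thesis
      by (simp add: L\<^sub>B_def svec_nth zvec_nth g_def K_def inner_add_right)
  qed
  have dg: "((\<lambda>r. g (p i + r * q i)) has_field_derivative smooth_pos K (p i) * q i) (at 0)" for i
  proof -
    \<comment> \<open>The point is written as the inner function at r = 0, the form in which
      \<open>DERIV_chain2\<close> expects it.\<close>
    have "(g has_field_derivative smooth_pos K (p i)) (at (p i + 0 * q i))"
      using has_field_derivative_barrier_term[OF K, of "p i"] by (simp add: g_def [abs_def])
    moreover have "((\<lambda>r. p i + r * q i) has_field_derivative q i) (at 0)"
      by (auto intro!: derivative_eq_intros)
    ultimately show ?thesis by (rule DERIV_chain2)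
  qed
  have "((\<lambda>r. L\<^sub>B A b c (y + r *\<^sub>R h) x \<mu> \<rho>) has_field_derivative
          - \<rho> * (b \<bullet> h) + (\<Sum>i\<in>UNIV. smooth_pos K (p i) * q i)) (at 0)"
    unfolding eq by (auto intro!: derivative_eq_intros dg DERIV_sum)
  moreover have "h \<bullet> (A *v zvec A c y x \<mu> \<rho> - \<rho> *\<^sub>R b)
      = - \<rho> * (b \<bullet> h) + (\<Sum>i\<in>UNIV. smooth_pos K (p i) * q i)"
    by (simp add: matrix_mult_sum inner_diff_right inner_sum_right q_def p_def zvec_nth K_def
        inner_commute scalar_mult_eq_scaleR)
  ultimately show ?thesis by simp
qed

lemma L\<^sub>B_minimizer_stationary:
  assumes "\<mu> > 0" "\<rho> > 0" and min: "\<And>y'. L\<^sub>B A b c y x \<mu> \<rho> \<le> L\<^sub>B A b c y' x \<mu> \<rho>"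
  shows "A *v zvec A c y x \<mu> \<rho> = \<rho> *\<^sub>R b"
proof -
  have "h \<bullet> (A *v zvec A c y x \<mu> \<rho> - \<rho> *\<^sub>R b) = 0" for h
    by (rule DERIV_local_min[OF L\<^sub>B_directional_derivative[OF assms(1,2)] zero_less_one])
       (simp add: min)
  \<comment> \<open>Taking the gradient itself as h makes its squared norm vanish.\<close>
  from this[of "A *v zvec A c y x \<mu> \<rho> - \<rho> *\<^sub>R b"] show ?thesis by simp
qed

text \<open>The ratio |t| / sqrt(t^2 + K) grows with |t|. It matters because the derivative of
  \<open>smooth_pos K\<close> is (1 + t / sqrt(t^2 + K)) / 2, which therefore stays away from 0 and
  1 on bounded sets.\<close>

lemma abs_le_sqrt_quotient:
  fixes K M t :: real
  assumes K: "K > 0" and t: "\<bar>t\<bar> \<le> M"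
  shows "\<bar>t\<bar> \<le> M / sqrt (M\<^sup>2 + K) * sqrt (t\<^sup>2 + K)"
proof -
  have M: "M \<ge> 0" using t by linarith
  have "t\<^sup>2 \<le> M\<^sup>2" using t by (rule power2_le_iff_abs_le[THEN iffD2, OF M])
  then have "t\<^sup>2 * (M\<^sup>2 + K) \<le> M\<^sup>2 * (t\<^sup>2 + K)"
    using K by (simp add: algebra_simps)
  then have "sqrt (t\<^sup>2 * (M\<^sup>2 + K)) \<le> sqrt (M\<^sup>2 * (t\<^sup>2 + K))"
    by (rule real_sqrt_le_mono)
  then have "\<bar>t\<bar> * sqrt (M\<^sup>2 + K) \<le> M * sqrt (t\<^sup>2 + K)"
    using M by (simp add: real_sqrt_mult)
  moreover have "sqrt (M\<^sup>2 + K) > 0" using K by (simp add: add_nonneg_pos)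
  ultimately show ?thesis by (simp add: field_simps)
qed

text \<open>The map t - \<open>smooth_pos K t\<close> equals (t - sqrt(t^2 + K)) / 2, so a Lipschitz
  constant q of the square root on [-M, M] gives (1 + q) / 2.\<close>

lemma smooth_pos_residual_le:
  assumes K: "K > 0" and "\<bar>a\<bar> \<le> M" "\<bar>b\<bar> \<le> M"
  shows "\<bar>(a - b) - (smooth_pos K a - smooth_pos K b)\<bar>
           \<le> (1 + M / sqrt (M\<^sup>2 + K)) / 2 * \<bar>a - b\<bar>"
proof -
  define q where "q = M / sqrt (M\<^sup>2 + K)"
  define ra where "ra = sqrt (a\<^sup>2 + K)"
  define rb where "rb = sqrt (b\<^sup>2 + K)"
  have pos: "ra > 0" "rb > 0" using K by (auto simp: ra_def rb_def add_nonneg_pos)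
  have sq: "ra\<^sup>2 = a\<^sup>2 + K" "rb\<^sup>2 = b\<^sup>2 + K"
    using K by (auto simp: ra_def rb_def add_nonneg_nonneg)
  have "\<bar>a\<bar> \<le> q * ra" "\<bar>b\<bar> \<le> q * rb"
    using abs_le_sqrt_quotient[OF K] assms by (auto simp: q_def ra_def rb_def)
  then have "\<bar>a + b\<bar> \<le> q * (ra + rb)" by (simp add: algebra_simps)
  \<comment> \<open>Both sides are differences of squares, as K cancels. Dividing by ra + rb > 0
    turns the bound on |a + b| into the Lipschitz constant q.\<close>
  have "(ra - rb) * (ra + rb) = (a - b) * (a + b)"
    using sq by (simp add: power2_eq_square algebra_simps)
  then have "\<bar>ra - rb\<bar> * (ra + rb) = \<bar>a - b\<bar> * \<bar>a + b\<bar>"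
    using pos by (metis abs_mult abs_of_pos add_pos_pos)
  also have "\<dots> \<le> \<bar>a - b\<bar> * (q * (ra + rb))"
    using \<open>\<bar>a + b\<bar> \<le> q * (ra + rb)\<close> by (rule mult_left_mono) simp
  finally have "\<bar>ra - rb\<bar> * (ra + rb) \<le> (q * \<bar>a - b\<bar>) * (ra + rb)"
    by (simp add: mult_ac)
  then have d: "\<bar>ra - rb\<bar> \<le> q * \<bar>a - b\<bar>"
    using pos by simp
  have "(a - b) - (smooth_pos K a - smooth_pos K b) = ((a - b) - (ra - rb)) / 2"
    by (simp add: smooth_pos_def ra_def rb_def field_simps)
  then have "\<bar>(a - b) - (smooth_pos K a - smooth_pos K b)\<bar> = \<bar>(a - b) - (ra - rb)\<bar> / 2"
    by (simp only: abs_divide abs_numeral)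
  also have "\<dots> \<le> (\<bar>a - b\<bar> + \<bar>ra - rb\<bar>) / 2"
    by (intro divide_right_mono abs_triangle_ineq4) simp
  also have "\<dots> \<le> (1 + q) / 2 * \<bar>a - b\<bar>" using d by (simp add: field_simps)
  finally show ?thesis by (simp add: q_def)
qed

text \<open>The factor is fixed before y and serves the whole ball of radius R. The constant
  constructed here tends to 1 as R grows, hence the restriction to a ball.\<close>

lemma zvec_residual_norm_le:
  fixes A :: "real^'n^'m"
  assumes "\<mu> > 0" "\<rho> > 0"
  obtains \<kappa> where "0 < \<kappa>" "\<kappa> < 1"
    "\<And>y. norm (transpose A *v (y - y\<^sub>0)) \<le> R \<Longrightarrow>
      norm (transpose A *v (y - y\<^sub>0) - (zvec A c y x \<mu> \<rho> - zvec A c y\<^sub>0 x \<mu> \<rho>))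
        \<le> \<kappa> * norm (transpose A *v (y - y\<^sub>0))"
proof -
  define K where "K = 4 * \<rho> * \<mu>"
  have K: "K > 0" using assms by (simp add: K_def)
  define t where "t y = (\<chi> i. \<rho> * x $ i - c $ i + column i A \<bullet> y)" for y :: "real^'m"
  \<comment> \<open>M bounds all arguments of \<open>smooth_pos\<close> on the ball; the absolute
    value keeps it nonnegative for every R.\<close>
  define M where "M = norm (t y\<^sub>0) + \<bar>R\<bar>"
  define \<kappa> where "\<kappa> = (1 + M / sqrt (M\<^sup>2 + K)) / 2"
  have M: "M \<ge> 0" by (simp add: M_def)
  have "M < sqrt (M\<^sup>2 + K)" using abs_less_sqrt_square_add[OF K, of M] by linarith
  then have "0 \<le> M / sqrt (M\<^sup>2 + K)" "M / sqrt (M\<^sup>2 + K) < 1"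
    using M K by (auto simp: divide_less_eq add_nonneg_pos)
  then have \<kappa>: "0 < \<kappa>" "\<kappa> < 1" by (auto simp: \<kappa>_def)
  have tdiff: "transpose A *v (y - y\<^sub>0) = t y - t y\<^sub>0" for y
    by (simp add: vec_eq_iff t_def matrix_vector_mult_def transpose_def column_def inner_vec_def
        algebra_simps sum_subtractf)
  show thesis
  proof (rule that[OF \<kappa>])
    fix y assume R: "norm (transpose A *v (y - y\<^sub>0)) \<le> R"
    have "norm (t y) \<le> norm (t y\<^sub>0) + norm (t y - t y\<^sub>0)" by norm
    then have bd: "norm (t y) \<le> M" "norm (t y\<^sub>0) \<le> M"
      using R unfolding tdiff by (auto simp: M_def)
    have "norm (t y - t y\<^sub>0 - (zvec A c y x \<mu> \<rho> - zvec A c y\<^sub>0 x \<mu> \<rho>)) \<le> norm (\<kappa> *\<^sub>R (t y - t y\<^sub>0))"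
    proof (rule norm_le_componentwise_cart)
      fix i
      have "\<bar>t y $ i\<bar> \<le> M" "\<bar>t y\<^sub>0 $ i\<bar> \<le> M"
        using bd component_le_norm_cart order_trans by blast+
      from smooth_pos_residual_le[OF K this]
      show "norm ((t y - t y\<^sub>0 - (zvec A c y x \<mu> \<rho> - zvec A c y\<^sub>0 x \<mu> \<rho>)) $ i)
            \<le> norm ((\<kappa> *\<^sub>R (t y - t y\<^sub>0)) $ i)"
        using \<kappa> by (simp add: zvec_nth K_def \<kappa>_def abs_mult t_def)
    qed
    then show "norm (transpose A *v (y - y\<^sub>0) - (zvec A c y x \<mu> \<rho> - zvec A c y\<^sub>0 x \<mu> \<rho>))
        \<le> \<kappa> * norm (transpose A *v (y - y\<^sub>0))"
      using \<kappa> unfolding tdiff by simp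
  qed
qed

lemma inner_gram:
  fixes A :: "real^'n^'m"
  shows "v \<bullet> ((A ** transpose A) *v w) = (transpose A *v v) \<bullet> (transpose A *v w)"
  by (simp add: dot_lmul_matrix matrix_vector_mul_assoc[symmetric])

lemma mnorm_gram_square:
  fixes A :: "real^'n^'m"
  shows "(mnorm (A ** transpose A) v)\<^sup>2 = (norm (transpose A *v v))\<^sup>2"
  by (simp add: mnorm_def inner_gram power2_norm_eq_inner)

text \<open>The hypothesis is the normal equation making A^T e the orthogonal projection of w onto
  the row space of A, and projections do not lengthen vectors.\<close>

lemma gram_solution_norm_le:
  fixes A :: "real^'n^'m"
  assumes "(A ** transpose A) *v e = A *v w"
  shows "norm (transpose A *v e) \<le> norm w"
proof -
  let ?v = "transpose A *v e"
  have "norm ?v * norm ?v = ?v \<bullet> w"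
    using arg_cong[OF assms, of "\<lambda>u. e \<bullet> u"]
    by (simp add: inner_gram dot_lmul_matrix flip: power2_norm_eq_inner power2_eq_square)
  also have "\<dots> \<le> norm ?v * norm w" by (rule norm_cauchy_schwarz)
  finally show ?thesis
    by (metis mult_le_cancel_left_pos norm_ge_zero zero_less_norm_iff norm_zero)
qed

text \<open>A vector killed by A^T is orthogonal to every column of A, in particular to those in I,
  so A_I A_I^T kills it too.\<close>

lemma inj_transpose_of_subgram:
  fixes A :: "real^'n^'m"
  assumes "positive_definite (subgram A I)"
  shows "inj ((*v) (transpose A))"
proof -
  have "v = 0" if "transpose A *v v = 0" for v
  proof (rule ccontr)
    assume "v \<noteq> 0"
    have col: "(\<Sum>q\<in>UNIV. A $ q $ i * v $ q) = 0" for i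
      using that by (simp add: vec_eq_iff matrix_vector_mult_def transpose_def)
    have "(subgram A I *v v) $ p = 0" for p
    proof -
      have "(subgram A I *v v) $ p = (\<Sum>i\<in>I. A $ p $ i * (\<Sum>q\<in>UNIV. A $ q $ i * v $ q))"
        by (simp add: subgram_def matrix_vector_mult_def sum_distrib_right sum_distrib_left
            mult.assoc sum.swap[of _ I UNIV])
      then show ?thesis by (simp add: col)
    qed
    then have "subgram A I *v v = 0" by (simp add: vec_eq_iff)
    then show False using assms \<open>v \<noteq> 0\<close> by (force simp: positive_definite_def)
  qed
  then show ?thesis
    by (simp add: linear_injective_0)
qed

theorem theorem5p5:
  fixes A :: "real^'n^'m" and b :: "real^'m" and c :: "real^'n"
    and x\<^sub>k :: "real^'n" and \<mu>\<^sub>k \<rho>\<^sub>k :: real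
    and F\<^sub>k :: "real^'m \<Rightarrow> real" and y\<^sub>k :: "real^'m"
    and yhat :: "nat \<Rightarrow> real^'m"
    and ystar :: "real^'m" and xstar sstar :: "real^'n"
    and I :: "'n set"
  assumes "\<mu>\<^sub>k > 0" and "\<rho>\<^sub>k > 0"
    and "F\<^sub>k = (\<lambda>y. L\<^sub>B A b c y x\<^sub>k \<mu>\<^sub>k \<rho>\<^sub>k)"
    and "is_arg_min F\<^sub>k (\<lambda>_. True) y\<^sub>k"
    and "\<And>l. (A ** transpose A) *v (yhat (Suc l) - yhat l) =
              - (A *v zvec A c (yhat l) x\<^sub>k \<mu>\<^sub>k \<rho>\<^sub>k - \<rho>\<^sub>k *\<^sub>R b)"
    and "lp_solution A c b ystar"
    and "lp_multiplier A b c ystar xstar"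
    and "sstar = c - transpose A *v ystar"
    and "\<And>i. (xstar + sstar) $ i > 0"
    and "I = {i. xstar $ i > 0}"
    and "columns_independent A I"
    and "card I = CARD('m)"
    and "positive_definite (subgram A I)"
  shows "(\<exists>\<tau>::real. 0 < \<tau> \<and> \<tau> < 1 \<and>
            (\<forall>l. (mnorm (A ** transpose A) (yhat l - y\<^sub>k))\<^sup>2
                 \<le> \<tau> ^ l * (mnorm (A ** transpose A) (yhat 0 - y\<^sub>k))\<^sup>2))
         \<and> yhat \<longlonglongrightarrow> y\<^sub>k"
proof -
  let ?T = "transpose A"
  let ?z = "\<lambda>y. zvec A c y x\<^sub>k \<mu>\<^sub>k \<rho>\<^sub>k"
  let ?u = "\<lambda>l. ?T *v (yhat l - y\<^sub>k)"
  have "L\<^sub>B A b c y\<^sub>k x\<^sub>k \<mu>\<^sub>k \<rho>\<^sub>k \<le> L\<^sub>B A b c y x\<^sub>k \<mu>\<^sub>k \<rho>\<^sub>k" for y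
    using assms(3,4) by (simp add: is_arg_min_linorder)
  then have stat: "A *v ?z y\<^sub>k = \<rho>\<^sub>k *\<^sub>R b"
    by (rule L\<^sub>B_minimizer_stationary[OF assms(1,2)])
  have step: "norm (?u (Suc l)) \<le> norm (?u l - (?z (yhat l) - ?z y\<^sub>k))" for l
  proof (rule gram_solution_norm_le)
    have "(A ** ?T) *v (yhat (Suc l) - y\<^sub>k)
        = (A ** ?T) *v (yhat l - y\<^sub>k) + (A ** ?T) *v (yhat (Suc l) - yhat l)"
      by (simp flip: matrix_vector_right_distrib)
    \<comment> \<open>Stationarity replaces rho b in the iteration by A z(y_k), so the right-hand
      side is A applied to one vector.\<close>
    then show "(A ** ?T) *v (yhat (Suc l) - y\<^sub>k) = A *v (?u l - (?z (yhat l) - ?z y\<^sub>k))"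
      unfolding assms(5) matrix_vector_mult_diff_distrib[of A "?u l"]
        matrix_vector_mult_diff_distrib[of A "?z (yhat l)"] stat
      by (simp only: matrix_vector_mul_assoc minus_diff_eq diff_diff_eq2 add_diff_eq)
  qed
  \<comment> \<open>The radius is the initial error, so one factor can serve all l.\<close>
  obtain \<kappa> where \<kappa>: "0 < \<kappa>" "\<kappa> < 1"
    and contr: "\<And>y. norm (?T *v (y - y\<^sub>k)) \<le> norm (?u 0) \<Longrightarrow>
      norm (?T *v (y - y\<^sub>k) - (?z y - ?z y\<^sub>k)) \<le> \<kappa> * norm (?T *v (y - y\<^sub>k))"
    using zvec_residual_norm_le[OF assms(1,2)] by blast
  have bound: "norm (?u l) \<le> \<kappa> ^ l * norm (?u 0)" for l
  proof (induction l)
    case (Suc l)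
    \<comment> \<open>The induction hypothesis itself keeps the iterate in the ball where
      \<open>contr\<close> applies.\<close>
    have "\<kappa> ^ l * norm (?u 0) \<le> norm (?u 0)"
      using \<kappa> by (simp add: mult_left_le_one_le power_le_one)
    then have "norm (?u l) \<le> norm (?u 0)" using Suc.IH by linarith
    with step[of l] contr[of "yhat l"] have "norm (?u (Suc l)) \<le> \<kappa> * norm (?u l)"
      by linarith
    also have "\<dots> \<le> \<kappa> * (\<kappa> ^ l * norm (?u 0))"
      using Suc.IH \<kappa> by (intro mult_left_mono) auto
    finally show ?case by (simp add: mult.assoc)
  qed simp
  \<comment> \<open>Squaring the norm bound makes the rate tau equal to the square of
    \<kappa>.\<close>
  have lin: "(mnorm (A ** ?T) (yhat l - y\<^sub>k))\<^sup>2 \<le> (\<kappa>\<^sup>2) ^ l * (mnorm (A ** ?T) (yhat 0 - y\<^sub>k))\<^sup>2" for l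
    using power_mono[OF bound[of l] norm_ge_zero, of 2]
    by (simp add: mnorm_gram_square power_mult_distrib power_even_eq flip: power_mult)
  \<comment> \<open>An injective linear map in finite dimension is bounded below; this carries decay
    of A^T (yhat_l - y_k) over to yhat_l - y_k.\<close>
  obtain B where B: "B > 0" "\<And>v. B * norm v \<le> norm (?T *v v)"
    using linear_inj_bounded_below_pos[OF matrix_vector_mul_linear
        inj_transpose_of_subgram[OF assms(13)]] by blast
  have null: "(\<lambda>l. \<kappa> ^ l * norm (?u 0) / B) \<longlonglongrightarrow> 0"
    using \<kappa> by (intro tendsto_divide_zero tendsto_mult_left_zero LIMSEQ_realpow_zero) auto
  have "norm (yhat l - y\<^sub>k) \<le> \<kappa> ^ l * norm (?u 0) / B" for l
    using order_trans[OF B(2) bound] B(1) by (simp only: pos_le_divide_eq mult.commute simp_thms)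
  then have "(\<lambda>l. yhat l - y\<^sub>k) \<longlonglongrightarrow> 0"
    by (intro Lim_null_comparison[OF always_eventually null] allI)
  then have "yhat \<longlonglongrightarrow> y\<^sub>k" by (rule LIM_zero_cancel)
  moreover have "0 < \<kappa>\<^sup>2" "\<kappa>\<^sup>2 < 1" using \<kappa> by (auto simp: power_less_one_iff)
  ultimately show ?thesis using lin by blast
qed

end
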